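(* Let $n$ be even and let $f:\{0,1\}^n\to\{0,1\}$ be the function with $f(x)=1$ iff the number represented in binary by the bits $x_1\dots x_{n/2}$ is strictly less than the number represented in binary by the bits $x_{n/2+1}\dots x_n$ (in both cases the first listed bit being the most significant), and $f(x)=0$ otherwise. Then the $Q$-value of $f$ is at least $2^{n/2}$.
   Context: A partial assignment is $b\in\{0,1,*\}^n$. For partial assignments $a,b$, $a\sim b$ means $a_i=b_i$ whenever $b_i\ne *$. For $l\in\{0,1\}$, $b_{x_i\leftarrow l}$ is $b$ with its $i$-th coordinate set to $l$. $b$ is a $0$-certificate ($1$-certificate) of $f$ if $f(a)=0$ ($f(a)=1$) for all $a\in\{0,1\}^n$ with $a\sim b$. A utility function $g:\{0,1,*\}^n\to\mathbb{Z}_{\ge0}$ is monotone if $g(b_{x_i\leftarrow l})\ge g(b)$ whenever $b_i=*$, $l\in\{0,1\}$; submodular if $g(b_{x_i\leftarrow l})-g(b)\ge g(b'_{x_i\leftarrow l})-g(b')$ whenever $b'\sim b$, $b_i=b'_i=*$, $l\in\{0,1\}$. $g$ is assignment feasible for $f$ with goal value $Q$ if $g$ is monotone and submodular, $g( *,\dots,* )=0$, and for all $b$, $g(b)=Q$ iff $b$ is a $0$-certificate or a $1$-certificate of $f$. The $Q$-value of $f$ is the minimum integer $Q$ such that some integer-valued utility function is assignment feasible for $f$ with goal value $Q$. *)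

theory Defs
  imports Main
begin

text \<open>
  An element of \<open>{0,1,*}\<^sup>n\<close> is a map with domain contained in \<open>{1..n}\<close>, where \<open>None\<close> is \<open>*\<close> and
  \<open>Some False\<close>, \<open>Some True\<close> are \<open>0\<close>, \<open>1\<close>; an element of \<open>{0,1}\<^sup>n\<close> is one whose domain is all of
  \<open>{1..n}\<close>. Accordingly \<open>b\<close> with its \<open>i\<close>-th coordinate set to \<open>l\<close> is \<open>b(i \<mapsto> l)\<close>, and
  \<open>a \<sim> b\<close> is \<open>b \<subseteq>\<^sub>m a\<close>. A Boolean function on \<open>{0,1}\<^sup>n\<close> only matters on total assignments, and a
  utility function only on partial assignments.
\<close>

definition partial_assignments :: "nat \<Rightarrow> (nat \<rightharpoonup> bool) set" where
  "partial_assignments n = {b. dom b \<subseteq> {1..n}}"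

definition assignments :: "nat \<Rightarrow> (nat \<rightharpoonup> bool) set" where
  "assignments n = {a. dom a = {1..n}}"

definition certificate :: "nat \<Rightarrow> ((nat \<rightharpoonup> bool) \<Rightarrow> bool) \<Rightarrow> bool \<Rightarrow> (nat \<rightharpoonup> bool) \<Rightarrow> bool" where
  "certificate n f v b \<longleftrightarrow> (\<forall>a\<in>assignments n. b \<subseteq>\<^sub>m a \<longrightarrow> f a = v)"

definition monotone_utility :: "nat \<Rightarrow> ((nat \<rightharpoonup> bool) \<Rightarrow> nat) \<Rightarrow> bool" where
  "monotone_utility n g \<longleftrightarrow>
     (\<forall>b\<in>partial_assignments n. \<forall>i\<in>{1..n}. \<forall>l. b i = None \<longrightarrow> g (b(i \<mapsto> l)) \<ge> g b)"

definition submodular_utility :: "nat \<Rightarrow> ((nat \<rightharpoonup> bool) \<Rightarrow> nat) \<Rightarrow> bool" where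
  "submodular_utility n g \<longleftrightarrow>
     (\<forall>b\<in>partial_assignments n. \<forall>b'\<in>partial_assignments n. \<forall>i\<in>{1..n}. \<forall>l.
        b \<subseteq>\<^sub>m b' \<and> b i = None \<and> b' i = None \<longrightarrow>
        int (g (b(i \<mapsto> l))) - int (g b) \<ge> int (g (b'(i \<mapsto> l))) - int (g b'))"

definition assignment_feasible ::
  "nat \<Rightarrow> ((nat \<rightharpoonup> bool) \<Rightarrow> bool) \<Rightarrow> ((nat \<rightharpoonup> bool) \<Rightarrow> nat) \<Rightarrow> nat \<Rightarrow> bool" where
  "assignment_feasible n f g Q \<longleftrightarrow>
     monotone_utility n g \<and> submodular_utility n g \<and> g Map.empty = 0 \<and>
     (\<forall>b\<in>partial_assignments n. g b = Q \<longleftrightarrow> certificate n f False b \<or> certificate n f True b)"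

text \<open>
  The minimum is over a nonempty set: writing \<open>N\<^sub>v b\<close> for the number of total assignments
  \<open>a \<sim> b\<close> with \<open>f a = v\<close>, the utility \<open>N\<^sub>0 * \<cdot> N\<^sub>1 * - N\<^sub>0 b \<cdot> N\<^sub>1 b\<close> (with \<open>*\<close> the empty partial
  assignment) is assignment feasible for \<open>f\<close> with goal value \<open>N\<^sub>0 * \<cdot> N\<^sub>1 *\<close>. A goal value is a
  value of \<open>g\<close> at total assignments, so no negative integer needs to be considered.
\<close>

definition Q_value :: "nat \<Rightarrow> ((nat \<rightharpoonup> bool) \<Rightarrow> bool) \<Rightarrow> nat" where
  "Q_value n f = (LEAST Q. \<exists>g. assignment_feasible n f g Q)"

text \<open>The number with binary digits \<open>x\<^sub>s\<^sub>+\<^sub>1 \<dots> x\<^sub>s\<^sub>+\<^sub>k\<close>, most significant digit first.\<close>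

definition binary_number :: "nat \<Rightarrow> nat \<Rightarrow> (nat \<rightharpoonup> bool) \<Rightarrow> nat" where
  "binary_number s k x = (\<Sum>i=1..k. of_bool (x (s + i) = Some True) * 2 ^ (k - i))"

definition less_than_function :: "nat \<Rightarrow> (nat \<rightharpoonup> bool) \<Rightarrow> bool" where
  "less_than_function n x \<longleftrightarrow>
     binary_number 0 (n div 2) x < binary_number (n div 2) (n div 2) x"

end

theory Submission
  imports Defs
begin

text \<open>
  Let \<open>g\<close> be assignment feasible with goal value \<open>Q\<close>, and let \<open>b\<close> be an assignment of the leading
  bits of both numbers under which they agree, with the next bits \<open>x\<close> and \<open>y\<close> unassigned. Since
  \<open>x = 0, y = 1\<close> settles the comparison, submodularity gives
  \<open>Q - g b \<ge> (Q - g (b, x = 0)) + (Q - g (b, y = 1))\<close>, and by monotonicity the summands are at least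
  \<open>Q - g (b, x = 0, y = 0)\<close> and \<open>Q - g (b, x = 1, y = 1)\<close>. So each further pair of bits doubles the
  deficit \<open>Q - g b\<close>. For the last pair both summands are positive because neither \<open>x = 0\<close> nor
  \<open>y = 1\<close> alone is a certificate, and the doubling starts at \<open>2\<close>.
\<close>

section \<open>Existence of assignment feasible utilities\<close>

definition extension_count ::
  "nat \<Rightarrow> ((nat \<rightharpoonup> bool) \<Rightarrow> bool) \<Rightarrow> bool \<Rightarrow> (nat \<rightharpoonup> bool) \<Rightarrow> nat" where
  "extension_count n f v b = card {a \<in> assignments n. b \<subseteq>\<^sub>m a \<and> f a = v}"

lemma finite_assignments: "finite (assignments n)"
proof -
  have "assignments n = {m. dom m = {1..n} \<and> ran m \<subseteq> UNIV}"
    by (auto simp: assignments_def)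
  then show ?thesis
    using finite_set_of_finite_maps[of "{1..n}" "UNIV :: bool set"] by simp
qed

text \<open>This makes the product of the two counts vanish exactly at certificates.\<close>

lemma extension_count_eq_0_iff: "extension_count n f v b = 0 \<longleftrightarrow> certificate n f (\<not> v) b"
  using finite_assignments[of n] by (auto simp: extension_count_def certificate_def)

lemma extension_count_antimono:
  assumes "b \<subseteq>\<^sub>m b'"
  shows "extension_count n f v b' \<le> extension_count n f v b"
  unfolding extension_count_def
  by (rule card_mono) (auto simp: finite_assignments intro: map_le_trans[OF assms])

lemma map_upd_le_iff:
  assumes "b i = None"
  shows "b(i \<mapsto> l) \<subseteq>\<^sub>m a \<longleftrightarrow> b \<subseteq>\<^sub>m a \<and> a i = Some l"
proof -
  have "dom (b(i \<mapsto> l)) = insert i (dom b)" "i \<notin> dom b"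
    using assms by auto
  then show ?thesis
    unfolding map_le_def by (auto split: if_splits)
qed

lemma extension_count_split:
  assumes "b i = None" "i \<in> {1..n}"
  shows "extension_count n f v b =
    extension_count n f v (b(i \<mapsto> l)) + extension_count n f v (b(i \<mapsto> \<not> l))"
proof -
  let ?E = "\<lambda>b. {a \<in> assignments n. b \<subseteq>\<^sub>m a \<and> f a = v}"
  have "a i = Some l \<or> a i = Some (\<not> l)" if "a \<in> assignments n" for a
  proof -
    have "i \<in> dom a"
      using that assms(2) by (simp add: assignments_def)
    then show ?thesis
      by auto
  qed
  then have "?E b = ?E (b(i \<mapsto> l)) \<union> ?E (b(i \<mapsto> \<not> l))"
    by (auto simp: map_upd_le_iff[of b i, OF assms(1)])
  moreover have "?E (b(i \<mapsto> l)) \<inter> ?E (b(i \<mapsto> \<not> l)) = {}"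
    by (auto simp: map_upd_le_iff[of b i, OF assms(1)])
  ultimately show ?thesis
    unfolding extension_count_def by (simp add: card_Un_disjoint finite_assignments)
qed

text \<open>\<open>Q_value\<close> is a \<open>LEAST\<close>, so a bound on all goal values
  transfers to it only if one exists. In the witness, \<open>h b\<close> counts the pairs of a
  0-input and a 1-input that both extend \<open>b\<close>, and \<open>g b\<close> counts the pairs
  already excluded by \<open>b\<close>.\<close>

theorem ex_assignment_feasible: "\<exists>g Q. assignment_feasible n f g Q"
proof -
  define N where "N = extension_count n f"
  define h where "h b = N False b * N True b" for b
  define g where "g b = h Map.empty - h b" for b
  have anti: "N v b' \<le> N v b" if "b \<subseteq>\<^sub>m b'" for v b b'
    unfolding N_def using that by (rule extension_count_antimono)
  \<comment> \<open>\<open>h b\<close> never exceeds \<open>h Map.empty\<close>, so the truncated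
    subtraction in \<open>g\<close> is exact.\<close>
  have g: "g b + h b = h Map.empty" for b
    unfolding g_def h_def by (simp add: anti mult_le_mono)
  \<comment> \<open>The newly excluded pairs: the 1-input has \<not> l at \<open>i\<close>, or it
    has \<open>l\<close> there and the 0-input has \<not> l. Products of counts shrink as
    \<open>b\<close> grows, which yields submodularity.\<close>
  have gain: "g (b(i \<mapsto> l)) = g b +
      (N False b * N True (b(i \<mapsto> \<not> l)) + N False (b(i \<mapsto> \<not> l)) * N True (b(i \<mapsto> l)))"
    if "b i = None" "i \<in> {1..n}" for b i l
  proof -
    have "N v b = N v (b(i \<mapsto> l)) + N v (b(i \<mapsto> \<not> l))" for v
      unfolding N_def using that by (rule extension_count_split)
    then have "h b = h (b(i \<mapsto> l)) +
      (N False b * N True (b(i \<mapsto> \<not> l)) + N False (b(i \<mapsto> \<not> l)) * N True (b(i \<mapsto> l)))"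
      unfolding h_def by (simp add: algebra_simps)
    with g[of b] g[of "b(i \<mapsto> l)"] show ?thesis
      by simp
  qed
  have "monotone_utility n g"
    by (simp add: monotone_utility_def gain)
  moreover have "submodular_utility n g"
    unfolding submodular_utility_def
  proof (intro ballI allI impI, elim conjE)
    fix b b' :: "nat \<rightharpoonup> bool" and i l
    assume i: "i \<in> {1..n}" and le: "b \<subseteq>\<^sub>m b'" and None: "b i = None" "b' i = None"
    have upd: "b(i \<mapsto> l') \<subseteq>\<^sub>m b'(i \<mapsto> l')" for l'
      using le by (rule map_le_upd)
    have "N False b' * N True (b'(i \<mapsto> \<not> l)) + N False (b'(i \<mapsto> \<not> l)) * N True (b'(i \<mapsto> l))
        \<le> N False b * N True (b(i \<mapsto> \<not> l)) + N False (b(i \<mapsto> \<not> l)) * N True (b(i \<mapsto> l))"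
      by (intro add_mono mult_le_mono anti upd le)
    then show "int (g (b'(i \<mapsto> l))) - int (g b') \<le> int (g (b(i \<mapsto> l))) - int (g b)"
      using gain[of b i l] gain[of b' i l] None i by linarith
  qed
  moreover have "g b = h Map.empty \<longleftrightarrow> certificate n f False b \<or> certificate n f True b" for b
  proof -
    have "g b = h Map.empty \<longleftrightarrow> h b = 0"
      using g[of b] by linarith
    then show ?thesis
      by (auto simp: h_def N_def extension_count_eq_0_iff)
  qed
  ultimately have "assignment_feasible n f g (h Map.empty)"
    by (simp add: assignment_feasible_def g_def)
  then show ?thesis
    by blast
qed

lemma Q_value_attained: "\<exists>g. assignment_feasible n f g (Q_value n f)"
proof -
  obtain Q where "\<exists>g. assignment_feasible n f g Q"
    using ex_assignment_feasible by blast
  then show ?thesis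
    unfolding Q_value_def by (rule LeastI)
qed

section \<open>The lower bound\<close>

lemma sum_low_powers_less: "(\<Sum>i=Suc j..k. (2::nat) ^ (k - i)) < 2 ^ (k - j)"
proof (induction k)
  case (Suc k)
  show ?case
  proof (cases "j \<le> k")
    case True
    have "(\<Sum>i=Suc j..k. (2::nat) ^ (Suc k - i)) = 2 * (\<Sum>i=Suc j..k. 2 ^ (k - i))"
      by (simp add: sum_distrib_left Suc_diff_le)
    with Suc True show ?thesis
      by (simp add: Suc_diff_le)
  qed simp
qed simp

text \<open>The digit after the common prefix contributes \<open>2 ^ (k - Suc j)\<close> to the
  second number only, and all lower digits of the first together stay below that.\<close>

lemma binary_number_less_if_first_difference:
  assumes eq: "\<And>i. i \<in> {1..j} \<Longrightarrow> x (s + i) = x (t + i)" and "j < k"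
    and s: "x (s + Suc j) = Some False" and t: "x (t + Suc j) = Some True"
  shows "binary_number s k x < binary_number t k x"
proof -
  let ?d = "\<lambda>r i. of_bool (x (r + i) = Some True) * (2::nat) ^ (k - i)"
  have split: "binary_number r k x =
      (\<Sum>i=1..j. ?d r i) + (?d r (Suc j) + (\<Sum>i=Suc (Suc j)..k. ?d r i))" for r
  proof -
    have "{1..k} = {1..j} \<union> {Suc j..k}"
      using \<open>j < k\<close> by auto
    then have "binary_number r k x = (\<Sum>i\<in>{1..j} \<union> {Suc j..k}. ?d r i)"
      by (simp only: binary_number_def)
    also have "\<dots> = (\<Sum>i=1..j. ?d r i) + (\<Sum>i=Suc j..k. ?d r i)"
      by (rule sum.union_disjoint) auto
    also have "(\<Sum>i=Suc j..k. ?d r i) = ?d r (Suc j) + (\<Sum>i=Suc (Suc j)..k. ?d r i)"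
      using \<open>j < k\<close> by (intro sum.atLeast_Suc_atMost) simp
    finally show ?thesis .
  qed
  have "(\<Sum>i=1..j. ?d s i) = (\<Sum>i=1..j. ?d t i)"
    by (rule sum.cong) (simp_all add: eq)
  moreover have "(\<Sum>i=Suc (Suc j)..k. ?d s i) < 2 ^ (k - Suc j)"
  proof -
    have "(\<Sum>i=Suc (Suc j)..k. ?d s i) \<le> (\<Sum>i=Suc (Suc j)..k. 2 ^ (k - i))"
      by (rule sum_mono) simp
    also have "\<dots> < 2 ^ (k - Suc j)"
      by (rule sum_low_powers_less)
    finally show ?thesis .
  qed
  ultimately show ?thesis
    unfolding split[of s] split[of t] using s t by simp
qed

lemma binary_number_cong:
  assumes "\<And>i. i \<in> {1..k} \<Longrightarrow> x (s + i) = y (t + i)"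
  shows "binary_number s k x = binary_number t k y"
  unfolding binary_number_def using assms by (intro sum.cong) auto

section \<open>Equal prefixes of the two numbers\<close>

definition agreeing_prefix :: "nat \<Rightarrow> nat \<Rightarrow> (nat \<rightharpoonup> bool) \<Rightarrow> bool" where
  "agreeing_prefix k j b \<longleftrightarrow>
     dom b = {1..j} \<union> {k + 1..k + j} \<and> (\<forall>i\<in>{1..j}. b i = b (k + i))"

lemma agreeing_prefix_Suc:
  assumes "agreeing_prefix k j b" "j < k"
  shows "agreeing_prefix k (Suc j) (b(Suc j \<mapsto> v, k + Suc j \<mapsto> v))"
proof -
  have "dom (b(Suc j \<mapsto> v, k + Suc j \<mapsto> v)) = {1..Suc j} \<union> {k + 1..k + Suc j}"
    using assms by (auto simp: agreeing_prefix_def)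
  moreover have "(b(Suc j \<mapsto> v, k + Suc j \<mapsto> v)) i = (b(Suc j \<mapsto> v, k + Suc j \<mapsto> v)) (k + i)"
    if "i \<in> {1..Suc j}" for i
    using assms that by (cases "i = Suc j") (auto simp: agreeing_prefix_def)
  ultimately show ?thesis
    by (simp add: agreeing_prefix_def)
qed

text \<open>\<open>agreeing_prefix\<close> fixes the domain exactly, so the next pair is free; for
  the same reason a prefix of length \<open>k\<close> is a total assignment.\<close>

lemma agreeing_prefix_next_None:
  assumes "agreeing_prefix k j b" "j < k"
  shows "b (Suc j) = None" "b (k + Suc j) = None"
proof -
  have "Suc j \<notin> dom b" "k + Suc j \<notin> dom b"
    using assms by (simp_all add: agreeing_prefix_def)
  then show "b (Suc j) = None" "b (k + Suc j) = None"
    by (simp_all add: domIff)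
qed

text \<open>In every total extension the first differing digit is the one just set, so the remaining
  bits cannot change the outcome.\<close>

lemma certificate_first_difference:
  assumes "agreeing_prefix k j b" "j < k"
  shows "certificate (2 * k) (less_than_function (2 * k)) True
    (b(Suc j \<mapsto> False, k + Suc j \<mapsto> True))"
  unfolding certificate_def
proof (intro ballI impI)
  fix a
  assume le: "b(Suc j \<mapsto> False, k + Suc j \<mapsto> True) \<subseteq>\<^sub>m a"
  have None: "b (Suc j) = None" "(b(Suc j \<mapsto> False)) (k + Suc j) = None"
    using agreeing_prefix_next_None[OF assms] assms(2) by simp_all
  have a: "b \<subseteq>\<^sub>m a" "a (Suc j) = Some False" "a (k + Suc j) = Some True"
    using le None by (simp_all only: map_upd_le_iff)
  have "a (0 + i) = a (k + i)" if "i \<in> {1..j}" for i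
  proof -
    have "i \<in> dom b" "k + i \<in> dom b" "b i = b (k + i)"
      using assms(1) that by (auto simp: agreeing_prefix_def)
    with a(1) show ?thesis
      by (simp add: map_le_def)
  qed
  then have "binary_number 0 k a < binary_number k k a"
    using a assms(2) by (intro binary_number_less_if_first_difference[where j = j]) simp_all
  then show "less_than_function (2 * k) a = True"
    by (simp add: less_than_function_def)
qed

lemma assignment_if_agreeing_prefix:
  assumes "agreeing_prefix k k b"
  shows "b \<in> assignments (2 * k)" "\<not> less_than_function (2 * k) b"
proof -
  show "b \<in> assignments (2 * k)"
    using assms by (auto simp: agreeing_prefix_def assignments_def)
  have "binary_number 0 k b = binary_number k k b"
    by (rule binary_number_cong) (use assms in \<open>simp add: agreeing_prefix_def\<close>)
  then show "\<not> less_than_function (2 * k) b"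
    by (simp add: less_than_function_def)
qed

section \<open>Certificates and the doubling of the deficit\<close>

lemma certificate_assignment:
  assumes "a \<in> assignments n"
  shows "certificate n f v a \<longleftrightarrow> f a = v"
proof -
  have "a' = a" if "a' \<in> assignments n" "a \<subseteq>\<^sub>m a'" for a'
  proof (rule map_le_antisym)
    show "a' \<subseteq>\<^sub>m a"
      using that assms by (simp add: assignments_def map_le_def)
  qed (fact that(2))
  with assms show ?thesis
    by (auto simp: certificate_def)
qed

lemma not_certificate_if_extensions_differ:
  assumes "a \<in> assignments n" "a' \<in> assignments n" "b \<subseteq>\<^sub>m a" "b \<subseteq>\<^sub>m a'" "\<not> f a" "f a'"
  shows "\<not> certificate n f v b"
  using assms by (auto simp: certificate_def)

text \<open>Induction on the number \<open>Suc d\<close> of free pairs; \<open>j\<close> and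
  \<open>b\<close> vary because the prefix grows as \<open>d\<close> falls. The additive form avoids
  truncated subtraction.\<close>

lemma agreeing_prefix_deficit:
  assumes feasible: "assignment_feasible (2 * k) (less_than_function (2 * k)) g Q"
    and "agreeing_prefix k j b" and "j + Suc d = k"
  shows "g b + 2 ^ Suc d \<le> Q"
  using assms(2,3)
proof (induction d arbitrary: j b)
  let ?f = "less_than_function (2 * k)"
  have mono: "g b \<le> g (b(i \<mapsto> l))"
    if "b \<in> partial_assignments (2 * k)" "i \<in> {1..2 * k}" "b i = None" for b i l
    using feasible that by (auto simp: assignment_feasible_def monotone_utility_def)
  have goal: "g b = Q \<longleftrightarrow> certificate (2 * k) ?f False b \<or> certificate (2 * k) ?f True b"
    if "b \<in> partial_assignments (2 * k)" for b
    using feasible that by (auto simp: assignment_feasible_def)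
  \<comment> \<open>Proved before the case split because both cases use it. The first inequality is
    submodularity at \<open>b\<close> and its extension by y = 1, setting x = 0; the next two
    complete each half to a longer agreeing prefix.\<close>
  have step: "g b + Q \<le> g (b(Suc j \<mapsto> False)) + g (b(k + Suc j \<mapsto> True)) \<and>
      g (b(Suc j \<mapsto> False)) \<le> g (b(Suc j \<mapsto> False, k + Suc j \<mapsto> False)) \<and>
      g (b(k + Suc j \<mapsto> True)) \<le> g (b(Suc j \<mapsto> True, k + Suc j \<mapsto> True)) \<and>
      b(Suc j \<mapsto> False) \<in> partial_assignments (2 * k) \<and>
      b(k + Suc j \<mapsto> True) \<in> partial_assignments (2 * k) \<and>
      b (Suc j) = None \<and> b (k + Suc j) = None"
    if b: "agreeing_prefix k j b" and j: "j < k" for j b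
  proof -
    let ?y = "b(k + Suc j \<mapsto> True)"
    have i: "Suc j \<in> {1..2 * k}" "k + Suc j \<in> {1..2 * k}"
      using j by auto
    note None = agreeing_prefix_next_None[OF b j]
    have pa: "b \<in> partial_assignments (2 * k)"
      using b j by (auto simp: agreeing_prefix_def partial_assignments_def)
    have pa': "b(Suc j \<mapsto> False) \<in> partial_assignments (2 * k)" "?y \<in> partial_assignments (2 * k)"
      using pa i by (auto simp: partial_assignments_def)
    have twist: "b(k + Suc j \<mapsto> True, Suc j \<mapsto> l) = b(Suc j \<mapsto> l, k + Suc j \<mapsto> True)" for l
      using j by (intro fun_upd_twist) simp
    have "b \<subseteq>\<^sub>m ?y"
      using None by (auto simp: map_le_def)
    then have "int (g (?y(Suc j \<mapsto> False))) - int (g ?y) \<le> int (g (b(Suc j \<mapsto> False))) - int (g b)"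
      using feasible pa pa'(2) i(1) None j
      unfolding assignment_feasible_def submodular_utility_def by simp
    moreover have "g (?y(Suc j \<mapsto> False)) = Q"
      unfolding twist using certificate_first_difference[OF b j] pa i
      by (subst goal) (auto simp: partial_assignments_def)
    moreover have "g (b(Suc j \<mapsto> False)) \<le> g (b(Suc j \<mapsto> False, k + Suc j \<mapsto> False))"
      using None j by (intro mono pa' i) simp
    moreover have "g ?y \<le> g (b(Suc j \<mapsto> True, k + Suc j \<mapsto> True))"
      unfolding twist[symmetric] using None j by (intro mono pa' i) simp
    ultimately show ?thesis
      using pa' None by simp
  qed
  {
    case 0
    then have j: "j < k" "Suc j = k"
      by simp_all
    note st = step[OF 0(1) j(1)]
    let ?a = "\<lambda>v. b(Suc j \<mapsto> v, k + Suc j \<mapsto> v)"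
    let ?a' = "b(Suc j \<mapsto> False, k + Suc j \<mapsto> True)"
    have prefix: "agreeing_prefix k k (?a v)" for v
      using agreeing_prefix_Suc[OF 0(1) j(1), of v] unfolding j(2) .
    note a = assignment_if_agreeing_prefix[OF prefix]
    have a': "?a' \<in> assignments (2 * k)"
      using a(1)[of False] by (simp add: assignments_def)
    then have f: "?f ?a'"
      using certificate_first_difference[OF 0(1) j(1)] by (simp add: certificate_assignment)
    have "g (?a v) = Q" for v
    proof -
      have "?a v \<in> partial_assignments (2 * k)"
        using a(1)[of v] by (auto simp: assignments_def partial_assignments_def)
      then show ?thesis
        using a[of v] by (simp add: goal certificate_assignment)
    qed
    \<comment> \<open>With x = 0 the last pair is still open: y = 0 gives equal numbers, y = 1 a
      strict inequality.\<close>
    moreover have "g (b(Suc j \<mapsto> False)) \<noteq> Q"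
    proof -
      have "b(Suc j \<mapsto> False) \<subseteq>\<^sub>m ?a False" "b(Suc j \<mapsto> False) \<subseteq>\<^sub>m ?a'"
        using st j by (auto simp: map_le_def)
      then show ?thesis
        using not_certificate_if_extensions_differ[where f = ?f, OF a(1) a' _ _ a(2) f] st goal
        by blast
    qed
    \<comment> \<open>Likewise with y = 1: equality for x = 1, strict inequality for x = 0.\<close>
    moreover have "g (b(k + Suc j \<mapsto> True)) \<noteq> Q"
    proof -
      have "b(k + Suc j \<mapsto> True) \<subseteq>\<^sub>m ?a True" "b(k + Suc j \<mapsto> True) \<subseteq>\<^sub>m ?a'"
        using st j by (auto simp: map_le_def)
      then show ?thesis
        using not_certificate_if_extensions_differ[where f = ?f, OF a(1) a' _ _ a(2) f] st goal
        by blast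
    qed
    \<comment> \<open>Two deficits of at least 1 add up to \<open>2 ^ Suc 0\<close>.\<close>
    ultimately have "g (b(Suc j \<mapsto> False)) < Q" "g (b(k + Suc j \<mapsto> True)) < Q"
      using st by (metis le_neq_implies_less)+
    with st show ?case
      by simp
  next
    case (Suc d)
    then have j: "j < k" "Suc j + Suc d = k"
      by simp_all
    \<comment> \<open>The value \<open>False\<close> bounds the deficit of the x = 0 half,
      \<open>True\<close> that of the y = 1 half.\<close>
    have "g (b(Suc j \<mapsto> v, k + Suc j \<mapsto> v)) + 2 ^ Suc d \<le> Q" for v
      using Suc.IH[OF agreeing_prefix_Suc[OF Suc.prems(1) j(1)] j(2)] .
    from this[of False] this[of True] step[OF Suc.prems(1) j(1)] show ?case
      by simp
  }
qed

theorem theorem3: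
  fixes n :: nat
  assumes "even n" and "n > 0"
  shows "Q_value n (less_than_function n) \<ge> 2 ^ (n div 2)"
proof -
  obtain k where n: "n = 2 * k"
    using assms(1) by blast
  with assms(2) obtain d where k: "0 + Suc d = k"
    by (cases k) auto
  obtain g where "assignment_feasible n (less_than_function n) g (Q_value n (less_than_function n))"
    using Q_value_attained by blast
  \<comment> \<open>The induction is entered at the empty prefix, where all \<open>k\<close> pairs
    are free.\<close>
  moreover have "agreeing_prefix k 0 Map.empty"
    by (simp add: agreeing_prefix_def)
  ultimately have "g Map.empty + 2 ^ Suc d \<le> Q_value n (less_than_function n)"
    unfolding n using k by (rule agreeing_prefix_deficit)
  then show ?thesis
    using n k by force
qed

end
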